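(* Let $R$ be a Gorenstein local ring, and let $B$ be any $R$-algebra or any finitely generated $R$-module. Then $\tau^{\mathrm{fg}}_B(R)=R$ if and only if $\tau_B(R)=R$.
   Context: $R$ is commutative Noetherian; $R$-algebras need not be Noetherian. For an $R$-module $B$, the module closure $\mathrm{cl}_B$ assigns to $R$-modules $N\subseteq M$ the submodule $N_M^{\mathrm{cl}_B}=\{u\in M: b\otimes u\in\operatorname{Im}(B\otimes_R N\to B\otimes_R M)\text{ for all } b\in B\}$. The test ideal is $\tau_B(R)=\bigcap_{N\subseteq M}(N:_R N_M^{\mathrm{cl}_B})$ over all (not necessarily finitely generated) $R$-modules $N\subseteq M$, and the finitistic test ideal is $\tau^{\mathrm{fg}}_B(R)=\bigcap(N:_R N_M^{\mathrm{cl}_B})$ over all $R$-modules $N\subseteq M$ with $M/N$ finitely generated. *)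

theory Defs
  imports "HOL-Algebra.Algebra"
begin

section \<open>Modules and algebras\<close>

text \<open>
  The structural predicates (\<open>module\<close>, \<open>submodule\<close>) are those of HOL-Algebra. A module is a
  record that extends ring records; its \<open>mult\<close> and \<open>one\<close> fields carry no meaning unless the
  module is an algebra.
\<close>

definition regular_module :: "('a, 'r) ring_scheme \<Rightarrow> ('a, 'a) module" where
  "regular_module R =
     \<lparr>carrier = carrier R, monoid.mult = monoid.mult R, one = one R,
      ring.zero = ring.zero R, add = add R, smult = monoid.mult R\<rparr>"

text \<open>
  The library's locale \<open>algebra\<close> requires the algebra to be commutative. Here an \<open>R\<close>-algebra is
  an associative unital ring with a ring homomorphism from \<open>R\<close> into its centre, and
  commutative algebras are a special case.
\<close>

locale associative_algebra = module + ring M +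
  assumes smult_mult_left:
      "\<lbrakk>a \<in> carrier R; x \<in> carrier M; y \<in> carrier M\<rbrakk> \<Longrightarrow>
        (a \<odot>\<^bsub>M\<^esub> x) \<otimes>\<^bsub>M\<^esub> y = a \<odot>\<^bsub>M\<^esub> (x \<otimes>\<^bsub>M\<^esub> y)"
    and smult_mult_right:
      "\<lbrakk>a \<in> carrier R; x \<in> carrier M; y \<in> carrier M\<rbrakk> \<Longrightarrow>
        x \<otimes>\<^bsub>M\<^esub> (a \<odot>\<^bsub>M\<^esub> y) = a \<odot>\<^bsub>M\<^esub> (x \<otimes>\<^bsub>M\<^esub> y)"

lemma algebra_imp_associative_algebra:
  assumes "algebra R B"
  shows "associative_algebra R B"
proof -
  interpret algebra R B by fact
  show ?thesis
  proof (intro associative_algebra.intro associative_algebra_axioms.intro)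
    show "module R B" by (rule module)
    show "ring B" by (rule cring.axioms(1)[OF M_cring])
    show "(a \<odot>\<^bsub>B\<^esub> x) \<otimes>\<^bsub>B\<^esub> y = a \<odot>\<^bsub>B\<^esub> (x \<otimes>\<^bsub>B\<^esub> y)"
      if "a \<in> carrier R" "x \<in> carrier B" "y \<in> carrier B" for a x y
      using that by (rule smult_assoc2)
    show "x \<otimes>\<^bsub>B\<^esub> (a \<odot>\<^bsub>B\<^esub> y) = a \<odot>\<^bsub>B\<^esub> (x \<otimes>\<^bsub>B\<^esub> y)"
      if "a \<in> carrier R" "x \<in> carrier B" "y \<in> carrier B" for a x y
      using that smult_assoc2[of a y x] comm_monoid.m_comm[OF cring.axioms(2)[OF M_cring]]
      by (metis smult_closed)
  qed
qed

definition mod_hom ::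
  "('a, 'r) ring_scheme \<Rightarrow> ('a, 'b) module \<Rightarrow> ('a, 'c) module \<Rightarrow> ('b \<Rightarrow> 'c) set" where
  "mod_hom R M N =
     {h \<in> hom (add_monoid M) (add_monoid N).
        \<forall>a\<in>carrier R. \<forall>x\<in>carrier M. h (a \<odot>\<^bsub>M\<^esub> x) = a \<odot>\<^bsub>N\<^esub> h x}"

definition submodule_span ::
  "('a, 'r) ring_scheme \<Rightarrow> ('a, 'b) module \<Rightarrow> 'b set \<Rightarrow> 'b set" where
  "submodule_span R M S = \<Inter>{H. submodule H R M \<and> S \<subseteq> H}"

definition finitely_generated :: "('a, 'r) ring_scheme \<Rightarrow> ('a, 'b) module \<Rightarrow> bool" where
  "finitely_generated R M \<longleftrightarrow>
     (\<exists>S. finite S \<and> S \<subseteq> carrier M \<and> submodule_span R M S = carrier M)"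

text \<open>
  In the scalar multiplication below all cosets in the union coincide when \<open>N\<close> is a submodule
  and \<open>Q\<close> a coset of it.
\<close>

definition quotient_module :: "('a, 'b) module \<Rightarrow> 'b set \<Rightarrow> ('a, 'b set) module" where
  "quotient_module M N =
     \<lparr>carrier = a_rcosets\<^bsub>M\<^esub> N, monoid.mult = undefined, one = undefined,
      ring.zero = N, add = set_add M, smult = (\<lambda>a Q. \<Union>x\<in>Q. N +>\<^bsub>M\<^esub> (a \<odot>\<^bsub>M\<^esub> x))\<rparr>"


section \<open>Tensor products\<close>

text \<open>
  \<open>B \<otimes>\<^sub>R M\<close> is the free abelian group on \<open>B \<times> M\<close> modulo the subgroup generated by the biadditivity
  and balancing relators. Only its underlying abelian group is needed below, since the image of a
  homomorphism, as a set, does not depend on the \<open>R\<close>-action.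
\<close>

definition tensor_relators ::
  "('a, 'r) ring_scheme \<Rightarrow> ('a, 'b) module \<Rightarrow> ('a, 'm) module \<Rightarrow> (('b \<times> 'm) \<Rightarrow>\<^sub>0 int) set" where
  "tensor_relators R B M =
     {frag_of (b \<oplus>\<^bsub>B\<^esub> b', m) - frag_of (b, m) - frag_of (b', m) | b b' m.
        b \<in> carrier B \<and> b' \<in> carrier B \<and> m \<in> carrier M} \<union>
     {frag_of (b, m \<oplus>\<^bsub>M\<^esub> m') - frag_of (b, m) - frag_of (b, m') | b m m'.
        b \<in> carrier B \<and> m \<in> carrier M \<and> m' \<in> carrier M} \<union>
     {frag_of (a \<odot>\<^bsub>B\<^esub> b, m) - frag_of (b, a \<odot>\<^bsub>M\<^esub> m) | a b m.
        a \<in> carrier R \<and> b \<in> carrier B \<and> m \<in> carrier M}"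

definition tensor_kernel ::
  "('a, 'r) ring_scheme \<Rightarrow> ('a, 'b) module \<Rightarrow> ('a, 'm) module \<Rightarrow> (('b \<times> 'm) \<Rightarrow>\<^sub>0 int) set" where
  "tensor_kernel R B M =
     generate (free_Abelian_group (carrier B \<times> carrier M)) (tensor_relators R B M)"

definition tensor_product ::
  "('a, 'r) ring_scheme \<Rightarrow> ('a, 'b) module \<Rightarrow> ('a, 'm) module \<Rightarrow>
     (('b \<times> 'm) \<Rightarrow>\<^sub>0 int) set monoid" where
  "tensor_product R B M =
     free_Abelian_group (carrier B \<times> carrier M) Mod tensor_kernel R B M"

definition tensor_class ::
  "('a, 'r) ring_scheme \<Rightarrow> ('a, 'b) module \<Rightarrow> ('a, 'm) module \<Rightarrow>
     (('b \<times> 'm) \<Rightarrow>\<^sub>0 int) \<Rightarrow> (('b \<times> 'm) \<Rightarrow>\<^sub>0 int) set" where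
  "tensor_class R B M c =
     tensor_kernel R B M #>\<^bsub>free_Abelian_group (carrier B \<times> carrier M)\<^esub> c"

definition pure_tensor ::
  "('a, 'r) ring_scheme \<Rightarrow> ('a, 'b) module \<Rightarrow> ('a, 'm) module \<Rightarrow>
     'b \<Rightarrow> 'm \<Rightarrow> (('b \<times> 'm) \<Rightarrow>\<^sub>0 int) set" where
  "pure_tensor R B M b m = tensor_class R B M (frag_of (b, m))"

text \<open>
  The map \<open>id \<otimes> f : B \<otimes> N \<rightarrow> B \<otimes> M\<close> induced by \<open>f : N \<rightarrow> M\<close>. For \<open>f\<close> linear and \<open>Q\<close> an element of
  \<open>B \<otimes> N\<close>, all classes in the union coincide.
\<close>

definition tensor_map ::
  "('a, 'r) ring_scheme \<Rightarrow> ('a, 'b) module \<Rightarrow> ('a, 'm) module \<Rightarrow> ('n \<Rightarrow> 'm) \<Rightarrow>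
     (('b \<times> 'n) \<Rightarrow>\<^sub>0 int) set \<Rightarrow> (('b \<times> 'm) \<Rightarrow>\<^sub>0 int) set" where
  "tensor_map R B M f Q =
     (\<Union>c\<in>Q. tensor_class R B M (frag_extend (\<lambda>(b, n). frag_of (b, f n)) c))"


section \<open>Module closures and test ideals\<close>

definition module_closure ::
  "('a, 'r) ring_scheme \<Rightarrow> ('a, 'b) module \<Rightarrow> ('a, 'm) module \<Rightarrow> 'm set \<Rightarrow> 'm set" where
  "module_closure R B M N =
     {u \<in> carrier M. \<forall>b\<in>carrier B.
        pure_tensor R B M b u \<in>
          tensor_map R B M id ` carrier (tensor_product R B (M\<lparr>carrier := N\<rparr>))}"

definition colon_ideal ::
  "('a, 'r) ring_scheme \<Rightarrow> ('a, 'm) module \<Rightarrow> 'm set \<Rightarrow> 'm set \<Rightarrow> 'a set" where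
  "colon_ideal R M N L = {a \<in> carrier R. \<forall>u\<in>L. a \<odot>\<^bsub>M\<^esub> u \<in> N}"

text \<open>
  HOL cannot quantify over all types inside a definition, so the intersections range over the
  modules whose carrier is a set of elements of a given type \<open>'m\<close>, which plays the role of a
  universe. A theorem in which \<open>'m\<close> is a free type variable is about modules of every size.
  Intersecting with \<open>carrier R\<close> changes nothing, as all colon ideals are contained in it.
\<close>

definition test_ideal ::
  "'m itself \<Rightarrow> ('a, 'r) ring_scheme \<Rightarrow> ('a, 'b) module \<Rightarrow> 'a set" where
  "test_ideal (_ :: 'm itself) R B =
     carrier R \<inter>
     \<Inter>{colon_ideal R M N (module_closure R B M N) | (M :: ('a, 'm) module) N.
         module R M \<and> submodule N R M}"

definition fg_test_ideal ::
  "'m itself \<Rightarrow> ('a, 'r) ring_scheme \<Rightarrow> ('a, 'b) module \<Rightarrow> 'a set" where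
  "fg_test_ideal (_ :: 'm itself) R B =
     carrier R \<inter>
     \<Inter>{colon_ideal R M N (module_closure R B M N) | (M :: ('a, 'm) module) N.
         module R M \<and> submodule N R M \<and> finitely_generated R (quotient_module M N)}"


section \<open>Gorenstein local rings\<close>

text \<open>
  The lifting property is tested on modules living in the same type \<open>'i\<close> as \<open>I\<close>. By Baer's
  criterion this is full injectivity as soon as \<open>R\<close> and its ideals have isomorphic copies in
  \<open>'i\<close>. That is the case where the notion is used below, because there \<open>R\<close> itself embeds
  into the first term of a resolution with carrier in \<open>'i\<close>.
\<close>

definition injective_module :: "('a, 'r) ring_scheme \<Rightarrow> ('a, 'i) module \<Rightarrow> bool" where
  "injective_module R I \<longleftrightarrow> module R I \<and>
     (\<forall>(A :: ('a, 'i) module) (C :: ('a, 'i) module) j g.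
        module R A \<and> module R C \<and> j \<in> mod_hom R A C \<and> inj_on j (carrier A) \<and>
        g \<in> mod_hom R A I \<longrightarrow>
        (\<exists>h\<in>mod_hom R C I. \<forall>x\<in>carrier A. h (j x) = g x))"

text \<open>
  \<open>M\<close> has an injective resolution \<open>0 \<rightarrow> M \<rightarrow> I\<^sub>0 \<rightarrow> I\<^sub>1 \<rightarrow> \<dots>\<close> with \<open>I\<^sub>k = 0\<close> for all large \<open>k\<close>,
  whose terms have their carriers in the type \<open>'i\<close>.
\<close>

definition finite_injective_dimension ::
  "'i itself \<Rightarrow> ('a, 'r) ring_scheme \<Rightarrow> ('a, 'b) module \<Rightarrow> bool" where
  "finite_injective_dimension (_ :: 'i itself) R M \<longleftrightarrow>
     (\<exists>(I :: nat \<Rightarrow> ('a, 'i) module) \<epsilon> d n.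
        (\<forall>k. injective_module R (I k)) \<and>
        \<epsilon> \<in> mod_hom R M (I 0) \<and>
        (\<forall>k. d k \<in> mod_hom R (I k) (I (Suc k))) \<and>
        inj_on \<epsilon> (carrier M) \<and>
        \<epsilon> ` carrier M = a_kernel (I 0) (I (Suc 0)) (d 0) \<and>
        (\<forall>k. d k ` carrier (I k) = a_kernel (I (Suc k)) (I (Suc (Suc k))) (d (Suc k))) \<and>
        (\<forall>k>n. carrier (I k) = {\<zero>\<^bsub>I k\<^esub>}))"

text \<open>
  As a hypothesis with a free type variable \<open>'i\<close>, this asserts the existence of a finite injective
  resolution over some type.
\<close>

definition gorenstein_local_ring :: "'i itself \<Rightarrow> ('a, 'r) ring_scheme \<Rightarrow> bool" where
  "gorenstein_local_ring (T :: 'i itself) R \<longleftrightarrow>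
     cring R \<and> noetherian_ring R \<and> (\<exists>!\<mm>. maximalideal \<mm> R) \<and>
     finite_injective_dimension T R (regular_module R)"

end

theory Submission
  imports Defs
begin

text \<open>
  The idea is that membership in a module closure is certified by finitely many elements of the
  module. Each condition \<open>b \<otimes> u \<in> Im(B \<otimes> N \<rightarrow> B \<otimes> M)\<close> is witnessed by a finite sum of relators of
  \<open>B \<otimes> M\<close> and generators from \<open>B \<times> N\<close>, and so it already holds over every submodule \<open>L\<close> that contains
  \<open>N\<close> and the finitely many elements of \<open>M\<close> that occur in the witness (\<open>image_lift_local\<close>).

  A priori there is one such condition for each \<open>b \<in> B\<close>. For fixed \<open>u\<close>, however, the elements \<open>b\<close> that
  satisfy it form an \<open>R\<close>-submodule of \<open>B\<close> that is stable under all \<open>R\<close>-endomorphisms of \<open>B\<close>, because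
  \<open>\<phi> \<otimes> id\<close> acts compatibly on \<open>B \<otimes> N\<close> and \<open>B \<otimes> M\<close>. It therefore suffices to test generators of
  \<open>B\<close> as a module over its endomorphism ring. Finitely many suffice in both situations of the
  theorem: for an algebra the single element \<open>1\<close>, since \<open>b\<close> is the image of \<open>1\<close> under left
  multiplication by \<open>b\<close>, and for a finitely generated module its generators.

  Write \<open>cl\<^sub>B(N, M)\<close> for the closure of \<open>N\<close> in \<open>M\<close>. Every element \<open>u\<close> of it lies in \<open>cl\<^sub>B(N, L)\<close> for some
  \<open>L\<close> that arises from \<open>N\<close> by adjoining finitely many elements (\<open>module_closure_finitistic\<close>), and \<open>L/N\<close> is finitely generated. If the finitistic test
  ideal is the unit ideal, then \<open>cl\<^sub>B(N, L) = N\<close>, so \<open>u \<in> N\<close>; thus every closure is trivial and the test ideal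
  is the unit ideal too. The converse is the inclusion of the test ideal in the finitistic one.
\<close>

section \<open>Subgroups of free abelian groups\<close>

text \<open>
  Relators over a submodule \<open>L \<subseteq> M\<close> and relators over \<open>M\<close> live in different free groups. Subgroups are
  therefore generated inside the free abelian group on the whole type, where they can be compared
  directly; \<open>generate_free_Abelian_group\<close> shows that the ambient group does not matter.
\<close>

definition frag_span :: "('x \<Rightarrow>\<^sub>0 int) set \<Rightarrow> ('x \<Rightarrow>\<^sub>0 int) set" where
  "frag_span A = generate (free_Abelian_group UNIV) A"

lemma frag_span_zero: "0 \<in> frag_span A"
  using generate.one[of "free_Abelian_group UNIV" A] by (simp add: frag_span_def)

lemma frag_span_incl: "x \<in> A \<Longrightarrow> x \<in> frag_span A"
  by (simp add: frag_span_def generate.incl)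

lemma frag_span_add: "x \<in> frag_span A \<Longrightarrow> y \<in> frag_span A \<Longrightarrow> x + y \<in> frag_span A"
  using generate.eng[of x "free_Abelian_group UNIV" A y] by (simp add: frag_span_def)

lemma frag_span_minus: "x \<in> frag_span A \<Longrightarrow> - x \<in> frag_span A"
  using group.generate_m_inv_closed[OF group_free_Abelian_group, of A UNIV x]
  by (simp add: frag_span_def subset_iff)

lemma frag_span_diff: "x \<in> frag_span A \<Longrightarrow> y \<in> frag_span A \<Longrightarrow> x - y \<in> frag_span A"
  using frag_span_add[of x A "- y"] frag_span_minus[of y A] by simp

lemma frag_span_mono: "A \<subseteq> A' \<Longrightarrow> frag_span A \<subseteq> frag_span A'"
  by (simp add: frag_span_def group.mono_generate)

lemma frag_span_induct [consumes 1, case_names zero incl minus add]: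
  assumes "x \<in> frag_span A"
    and zero: "P 0"
    and incl: "\<And>x. x \<in> A \<Longrightarrow> P x"
    and minus: "\<And>x. P x \<Longrightarrow> P (- x)"
    and add: "\<And>x y. P x \<Longrightarrow> P y \<Longrightarrow> P (x + y)"
  shows "P x"
  using assms(1) unfolding frag_span_def
  by (induction rule: generate.induct) (simp_all add: zero incl minus add)

lemma generate_free_Abelian_group:
  assumes "\<And>c. c \<in> A \<Longrightarrow> Poly_Mapping.keys c \<subseteq> S"
  shows "generate (free_Abelian_group S) A = frag_span A"
proof
  have A: "A \<subseteq> carrier (free_Abelian_group S)"
    using assms by auto
  show "generate (free_Abelian_group S) A \<subseteq> frag_span A"
  proof
    fix x assume "x \<in> generate (free_Abelian_group S) A"
    then show "x \<in> frag_span A"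
      by (induction rule: generate.induct)
        (simp_all add: assms frag_span_zero frag_span_incl frag_span_minus frag_span_add)
  qed
  show "frag_span A \<subseteq> generate (free_Abelian_group S) A"
  proof
    fix x assume "x \<in> frag_span A"
    then have "x \<in> generate (free_Abelian_group S) A \<and> Poly_Mapping.keys x \<subseteq> S"
    proof (induction rule: frag_span_induct)
      case zero
      show ?case using generate.one[of "free_Abelian_group S" A] by simp
    next
      case (incl x)
      then show ?case using assms by (simp add: generate.incl)
    next
      case (minus x)
      then show ?case
        using group.generate_m_inv_closed[OF group_free_Abelian_group A, of x] by simp
    next
      case (add x y)
      then show ?case
        using generate.eng[of x "free_Abelian_group S" A y] keys_add[of x y] by auto
    qed
    then show "x \<in> generate (free_Abelian_group S) A" ..
  qed
qed

lemma frag_span_frag_of: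
  assumes "Poly_Mapping.keys c \<subseteq> S"
  shows "c \<in> frag_span (frag_of ` S)"
  by (rule free_Abelian_group_induct[OF assms])
    (simp_all add: frag_span_zero frag_span_diff frag_span_incl)

lemma frag_span_Un_frag_of:
  "x \<in> frag_span (A \<union> frag_of ` S) \<longleftrightarrow>
     (\<exists>c. Poly_Mapping.keys c \<subseteq> S \<and> x - c \<in> frag_span A)"
proof
  assume "x \<in> frag_span (A \<union> frag_of ` S)"
  then show "\<exists>c. Poly_Mapping.keys c \<subseteq> S \<and> x - c \<in> frag_span A"
  proof (induction rule: frag_span_induct)
    case zero
    show ?case by (rule exI[of _ 0]) (simp add: frag_span_zero)
  next
    case (incl x)
    then consider "x \<in> A" | s where "s \<in> S" "x = frag_of s" by auto
    then show ?case
    proof cases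
      case 1
      then show ?thesis by (intro exI[of _ 0]) (simp add: frag_span_incl)
    next
      case 2
      then show ?thesis by (intro exI[of _ x]) (simp add: frag_span_zero)
    qed
  next
    case (minus x)
    then obtain c where "Poly_Mapping.keys c \<subseteq> S" "x - c \<in> frag_span A" by blast
    then show ?case
      using frag_span_minus[of "x - c" A] by (intro exI[of _ "- c"]) simp
  next
    case (add x y)
    then obtain c d where "Poly_Mapping.keys c \<subseteq> S" "x - c \<in> frag_span A"
      "Poly_Mapping.keys d \<subseteq> S" "y - d \<in> frag_span A" by blast
    then show ?case
      using frag_span_add[of "x - c" A "y - d"] keys_add[of c d]
      by (intro exI[of _ "c + d"]) (auto simp: algebra_simps)
  qed
next
  assume "\<exists>c. Poly_Mapping.keys c \<subseteq> S \<and> x - c \<in> frag_span A"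
  then obtain c where c: "Poly_Mapping.keys c \<subseteq> S" "x - c \<in> frag_span A" by blast
  have "x - c \<in> frag_span (A \<union> frag_of ` S)"
    using c(2) frag_span_mono[of A "A \<union> frag_of ` S"] by blast
  moreover have "c \<in> frag_span (A \<union> frag_of ` S)"
    using frag_span_frag_of[OF c(1)] frag_span_mono[of "frag_of ` S" "A \<union> frag_of ` S"] by blast
  ultimately show "x \<in> frag_span (A \<union> frag_of ` S)"
    using frag_span_add[of "x - c" _ c] by simp
qed

lemma frag_extend_frag_span:
  assumes "x \<in> frag_span A" and "\<And>a. a \<in> A \<Longrightarrow> frag_extend f a \<in> frag_span A'"
  shows "frag_extend f x \<in> frag_span A'"
  using assms(1)
  by (induction rule: frag_span_induct)
    (simp_all add: assms(2) frag_span_zero frag_span_minus frag_span_add frag_extend_minus frag_extend_add)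


section \<open>Membership in the image of a tensor product\<close>

text \<open>
  The preimage in the free abelian group on \<open>B \<times> M\<close> of the image of \<open>B \<otimes> N\<close> in \<open>B \<otimes> M\<close>. Working with
  this subgroup instead of the image itself replaces cosets by finite sums of generators.
\<close>

definition image_lift ::
  "('a, 'r) ring_scheme \<Rightarrow> ('a, 'b) module \<Rightarrow> ('a, 'm) module \<Rightarrow> 'm set \<Rightarrow>
     (('b \<times> 'm) \<Rightarrow>\<^sub>0 int) set" where
  "image_lift R B M N = frag_span (tensor_relators R B M \<union> frag_of ` (carrier B \<times> N))"

lemma tensor_relators_intros:
  "\<lbrakk>b \<in> carrier B; b' \<in> carrier B; m \<in> carrier M\<rbrakk> \<Longrightarrow>
    frag_of (b \<oplus>\<^bsub>B\<^esub> b', m) - frag_of (b, m) - frag_of (b', m) \<in> tensor_relators R B M"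
  "\<lbrakk>b \<in> carrier B; m \<in> carrier M; m' \<in> carrier M\<rbrakk> \<Longrightarrow>
    frag_of (b, m \<oplus>\<^bsub>M\<^esub> m') - frag_of (b, m) - frag_of (b, m') \<in> tensor_relators R B M"
  "\<lbrakk>a \<in> carrier R; b \<in> carrier B; m \<in> carrier M\<rbrakk> \<Longrightarrow>
    frag_of (a \<odot>\<^bsub>B\<^esub> b, m) - frag_of (b, a \<odot>\<^bsub>M\<^esub> m) \<in> tensor_relators R B M"
  unfolding tensor_relators_def by blast+

lemma tensor_relators_cases [consumes 1, case_names add_left add_right balance]:
  assumes "c \<in> tensor_relators R B M"
  obtains b b' m where "c = frag_of (b \<oplus>\<^bsub>B\<^esub> b', m) - frag_of (b, m) - frag_of (b', m)"
      "b \<in> carrier B" "b' \<in> carrier B" "m \<in> carrier M"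
    | b m m' where "c = frag_of (b, m \<oplus>\<^bsub>M\<^esub> m') - frag_of (b, m) - frag_of (b, m')"
      "b \<in> carrier B" "m \<in> carrier M" "m' \<in> carrier M"
    | a b m where "c = frag_of (a \<odot>\<^bsub>B\<^esub> b, m) - frag_of (b, a \<odot>\<^bsub>M\<^esub> m)"
      "a \<in> carrier R" "b \<in> carrier B" "m \<in> carrier M"
  using assms unfolding tensor_relators_def by (elim UnE CollectE exE conjE)

lemma tensor_relators_keys:
  assumes "module R B" "module R M" "c \<in> tensor_relators R B M"
  shows "Poly_Mapping.keys c \<subseteq> carrier B \<times> carrier M"
proof -
  interpret B: module R B by fact
  interpret M: module R M by fact
  have diff: "Poly_Mapping.keys (x - y) \<subseteq> S"
    if "Poly_Mapping.keys x \<subseteq> S" "Poly_Mapping.keys y \<subseteq> S" for x y :: "_ \<Rightarrow>\<^sub>0 int" and S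
    using that keys_diff[of x y] by blast
  from assms(3) show ?thesis
  proof (cases rule: tensor_relators_cases)
    case (add_left b b' m)
    show ?thesis unfolding add_left(1) by (intro diff) (simp_all add: add_left(2-))
  next
    case (add_right b m m')
    show ?thesis unfolding add_right(1) by (intro diff) (simp_all add: add_right(2-))
  next
    case (balance a b m)
    show ?thesis unfolding balance(1) by (intro diff) (simp_all add: balance(2-))
  qed
qed

lemma tensor_kernel_eq:
  assumes "module R B" "module R M"
  shows "tensor_kernel R B M = frag_span (tensor_relators R B M)"
  unfolding tensor_kernel_def
  by (rule generate_free_Abelian_group) (rule tensor_relators_keys[OF assms])

lemma tensor_relators_mono:
  assumes "N \<subseteq> N'"
  shows "tensor_relators R B (M\<lparr>carrier := N\<rparr>) \<subseteq> tensor_relators R B (M\<lparr>carrier := N'\<rparr>)"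
  using assms unfolding tensor_relators_def by (intro Un_mono) auto

lemma tensor_class_eq:
  assumes "module R B" "module R M"
  shows "tensor_class R B M c = {x. x - c \<in> frag_span (tensor_relators R B M)}"
proof -
  have "tensor_class R B M c = {k + c | k. k \<in> frag_span (tensor_relators R B M)}"
    by (auto simp: tensor_class_def tensor_kernel_eq[OF assms] r_coset_def)
  also have "\<dots> = {x. x - c \<in> frag_span (tensor_relators R B M)}"
    by (auto, metis diff_add_cancel)
  finally show ?thesis .
qed

lemma tensor_class_cong:
  assumes "module R B" "module R M" "x - y \<in> frag_span (tensor_relators R B M)"
  shows "tensor_class R B M x = tensor_class R B M y"
proof -
  have "z - x \<in> frag_span (tensor_relators R B M) \<longleftrightarrow> z - y \<in> frag_span (tensor_relators R B M)" for z
  proof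
    assume "z - x \<in> frag_span (tensor_relators R B M)"
    from frag_span_add[OF this assms(3)] show "z - y \<in> frag_span (tensor_relators R B M)" by simp
  next
    assume "z - y \<in> frag_span (tensor_relators R B M)"
    from frag_span_diff[OF this assms(3)] show "z - x \<in> frag_span (tensor_relators R B M)" by simp
  qed
  then show ?thesis by (simp add: tensor_class_eq[OF assms(1,2)])
qed

text \<open>
  Relators over \<open>N\<close> are relators over \<open>M\<close>, so all representatives of a class in \<open>B \<otimes> N\<close> lie in one
  class of \<open>B \<otimes> M\<close>, and the union that defines the induced map is that class.
\<close>

lemma tensor_map_id_class:
  assumes B: "module R B" and M: "module R M" and N: "submodule N R M"
  shows "tensor_map R B M id (tensor_class R B (M\<lparr>carrier := N\<rparr>) c) = tensor_class R B M c"
proof -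
  let ?N = "M\<lparr>carrier := N\<rparr>"
  have N': "module R ?N" by (rule submodule.submodule_is_module[OF N M])
  have NM: "N \<subseteq> carrier M" using module.submoduleE(1)[OF M N] .
  have "tensor_relators R B ?N \<subseteq> tensor_relators R B M"
    using tensor_relators_mono[OF NM, of R B M] by simp
  then have sub: "frag_span (tensor_relators R B ?N) \<subseteq> frag_span (tensor_relators R B M)"
    by (rule frag_span_mono)
  have ext: "frag_extend (\<lambda>(b, n). frag_of (b, id n)) x = x" for x
    using frag_expansion[of x] by (simp add: case_prod_unfold)
  have "tensor_class R B M x = tensor_class R B M c" if "x \<in> tensor_class R B ?N c" for x
    using that sub by (intro tensor_class_cong[OF B M]) (auto simp: tensor_class_eq[OF B N'])
  moreover have "c \<in> tensor_class R B ?N c"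
    by (simp add: tensor_class_eq[OF B N'] frag_span_zero)
  ultimately show ?thesis unfolding tensor_map_def ext by blast
qed

lemma pure_tensor_in_image_iff:
  assumes B: "module R B" and M: "module R M" and N: "submodule N R M"
  shows "pure_tensor R B M b u \<in>
      tensor_map R B M id ` carrier (tensor_product R B (M\<lparr>carrier := N\<rparr>)) \<longleftrightarrow>
    frag_of (b, u) \<in> image_lift R B M N"
proof -
  let ?N = "M\<lparr>carrier := N\<rparr>"
  have "carrier (tensor_product R B ?N) =
      tensor_class R B ?N ` {c. Poly_Mapping.keys c \<subseteq> carrier B \<times> N}"
    by (auto simp: tensor_product_def FactGroup_def RCOSETS_def tensor_class_def)
  then have "tensor_map R B M id ` carrier (tensor_product R B ?N) =
      tensor_class R B M ` {c. Poly_Mapping.keys c \<subseteq> carrier B \<times> N}"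
    by (simp add: image_image tensor_map_id_class[OF assms])
  moreover have "tensor_class R B M x = tensor_class R B M c \<longleftrightarrow>
      x - c \<in> frag_span (tensor_relators R B M)" for x c
  proof
    assume "tensor_class R B M x = tensor_class R B M c"
    moreover have "x \<in> tensor_class R B M x"
      by (simp add: tensor_class_eq[OF B M] frag_span_zero)
    ultimately show "x - c \<in> frag_span (tensor_relators R B M)"
      by (simp add: tensor_class_eq[OF B M])
  qed (rule tensor_class_cong[OF B M])
  ultimately show ?thesis
    unfolding pure_tensor_def image_lift_def frag_span_Un_frag_of by auto
qed

lemma module_closure_eq:
  assumes "module R B" "module R M" "submodule N R M"
  shows "module_closure R B M N =
    {u \<in> carrier M. \<forall>b\<in>carrier B. frag_of (b, u) \<in> image_lift R B M N}"
  unfolding module_closure_def pure_tensor_in_image_iff[OF assms] ..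

text \<open>
  The reason that the finitistic closures exhaust the closure. A generator mentions at most two
  elements of \<open>M\<close> besides those of \<open>N\<close>; the sum or multiple of them that a relator also contains is
  computed by the same operations over any \<open>L\<close>, so \<open>L\<close> may be an arbitrary set here.
\<close>

lemma image_lift_local:
  assumes "x \<in> image_lift R B M N"
  shows "\<exists>F. finite F \<and> F \<subseteq> carrier M \<and>
    (\<forall>L. F \<subseteq> L \<longrightarrow> x \<in> image_lift R B (M\<lparr>carrier := L\<rparr>) N)"
  using assms unfolding image_lift_def
proof (induction rule: frag_span_induct)
  case zero
  show ?case by (intro exI[of _ "{}"]) (simp add: frag_span_zero)
next
  case (incl x)
  have "\<exists>F. finite F \<and> F \<subseteq> carrier M \<and>
      (\<forall>L. F \<subseteq> L \<longrightarrow> x \<in> tensor_relators R B (M\<lparr>carrier := L\<rparr>) \<union> frag_of ` (carrier B \<times> N))"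
    using incl
  proof
    assume "x \<in> tensor_relators R B M"
    then show ?thesis
    proof (cases rule: tensor_relators_cases)
      case (add_left b b' m)
      have "x \<in> tensor_relators R B (M\<lparr>carrier := L\<rparr>)" if "{m} \<subseteq> L" for L
        using that tensor_relators_intros(1)[of b B b' m "M\<lparr>carrier := L\<rparr>" R] add_left by simp
      then show ?thesis
        using add_left(4) by (intro exI[of _ "{m}"]) simp
    next
      case (add_right b m m')
      have "x \<in> tensor_relators R B (M\<lparr>carrier := L\<rparr>)" if "{m, m'} \<subseteq> L" for L
        using that tensor_relators_intros(2)[of b B m "M\<lparr>carrier := L\<rparr>" m' R] add_right by simp
      then show ?thesis
        using add_right(3,4) by (intro exI[of _ "{m, m'}"]) simp
    next
      case (balance a b m)
      have "x \<in> tensor_relators R B (M\<lparr>carrier := L\<rparr>)" if "{m} \<subseteq> L" for L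
        using that tensor_relators_intros(3)[of a R b B m "M\<lparr>carrier := L\<rparr>"] balance by simp
      then show ?thesis
        using balance(4) by (intro exI[of _ "{m}"]) simp
    qed
  qed blast
  then obtain F where "finite F" "F \<subseteq> carrier M"
    "\<forall>L. F \<subseteq> L \<longrightarrow> x \<in> tensor_relators R B (M\<lparr>carrier := L\<rparr>) \<union> frag_of ` (carrier B \<times> N)"
    by (elim exE conjE)
  then show ?case by (intro exI[of _ F]) (simp add: frag_span_incl)
next
  case (minus x)
  then obtain F where "finite F" "F \<subseteq> carrier M"
    "\<forall>L. F \<subseteq> L \<longrightarrow>
      x \<in> frag_span (tensor_relators R B (M\<lparr>carrier := L\<rparr>) \<union> frag_of ` (carrier B \<times> N))"
    by (elim exE conjE)
  then show ?case by (intro exI[of _ F]) (simp add: frag_span_minus)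
next
  case (add x y)
  then obtain F G where "finite F" "F \<subseteq> carrier M"
    "\<forall>L. F \<subseteq> L \<longrightarrow>
      x \<in> frag_span (tensor_relators R B (M\<lparr>carrier := L\<rparr>) \<union> frag_of ` (carrier B \<times> N))"
    "finite G" "G \<subseteq> carrier M"
    "\<forall>L. G \<subseteq> L \<longrightarrow>
      y \<in> frag_span (tensor_relators R B (M\<lparr>carrier := L\<rparr>) \<union> frag_of ` (carrier B \<times> N))"
    by (elim exE conjE)
  then show ?case by (intro exI[of _ "F \<union> G"]) (simp add: frag_span_add)
qed


section \<open>Generation over the endomorphism ring\<close>

text \<open>
  Finite generation of \<open>B\<close> as a left module over its ring of \<open>R\<close>-endomorphisms, expressed by submodules
  of \<open>B\<close> that all endomorphisms map into themselves. It is the common feature of algebras and of finitely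
  generated modules on which the proof rests.
\<close>

definition End_finitely_generated ::
  "('a, 'r) ring_scheme \<Rightarrow> ('a, 'b) module \<Rightarrow> bool" where
  "End_finitely_generated R B \<longleftrightarrow>
     (\<exists>S. finite S \<and> S \<subseteq> carrier B \<and>
       (\<forall>H. submodule H R B \<and> (\<forall>\<phi>\<in>mod_hom R B B. \<phi> ` H \<subseteq> H) \<and> S \<subseteq> H \<longrightarrow> carrier B \<subseteq> H))"

lemma finitely_generated_imp_End_finitely_generated:
  assumes "finitely_generated R B"
  shows "End_finitely_generated R B"
proof -
  obtain S where S: "finite S" "S \<subseteq> carrier B" "submodule_span R B S = carrier B"
    using assms unfolding finitely_generated_def by (elim exE conjE)
  have "carrier B \<subseteq> H" if "submodule H R B" "S \<subseteq> H" for H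
    unfolding S(3)[symmetric] submodule_span_def using that by (intro Inter_lower) simp
  then show ?thesis
    unfolding End_finitely_generated_def using S(1,2) by (intro exI[of _ S]) simp
qed

lemma associative_algebra_imp_End_finitely_generated:
  assumes "associative_algebra R B"
  shows "End_finitely_generated R B"
  unfolding End_finitely_generated_def
proof (intro exI conjI allI impI subsetI)
  interpret associative_algebra R B by fact
  show "finite {\<one>\<^bsub>B\<^esub>}" by simp
  show "x \<in> carrier B" if "x \<in> {\<one>\<^bsub>B\<^esub>}" for x using that by simp
  fix H b
  assume H: "submodule H R B \<and> (\<forall>\<phi>\<in>mod_hom R B B. \<phi> ` H \<subseteq> H) \<and> {\<one>\<^bsub>B\<^esub>} \<subseteq> H"
    and b: "b \<in> carrier B"
  \<comment> \<open>Left multiplication is \<open>R\<close>-linear because scalars are central, and it sends \<open>1\<close> to \<open>b\<close>.\<close>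
  have "(\<lambda>c. b \<otimes>\<^bsub>B\<^esub> c) \<in> mod_hom R B B"
    unfolding mod_hom_def
    by (intro CollectI conjI homI ballI) (use b in \<open>simp_all add: r_distr smult_mult_right\<close>)
  with H have "(\<lambda>c. b \<otimes>\<^bsub>B\<^esub> c) ` H \<subseteq> H" by simp
  moreover have "\<one>\<^bsub>B\<^esub> \<in> H" using H by simp
  ultimately have "b \<otimes>\<^bsub>B\<^esub> \<one>\<^bsub>B\<^esub> \<in> H" by blast
  then show "b \<in> H" using b by simp
qed

text \<open>
  The endomorphism \<open>\<phi> \<otimes> id\<close> of the free group maps relators to relators of the same kind and
  generators from \<open>B \<times> N\<close> to such generators.
\<close>

lemma image_lift_endomorphism:
  assumes \<phi>: "\<phi> \<in> mod_hom R B B" and x: "frag_of (b, u) \<in> image_lift R B M N"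
  shows "frag_of (\<phi> b, u) \<in> image_lift R B M N"
proof -
  let ?f = "\<lambda>(b, m). frag_of (\<phi> b, m)"
  have cl: "\<phi> b \<in> carrier B" if "b \<in> carrier B" for b
    using \<phi> that by (auto simp: mod_hom_def hom_def)
  have add: "\<phi> (b \<oplus>\<^bsub>B\<^esub> b') = \<phi> b \<oplus>\<^bsub>B\<^esub> \<phi> b'" if "b \<in> carrier B" "b' \<in> carrier B" for b b'
    using \<phi> that by (auto simp: mod_hom_def hom_def)
  have smult: "\<phi> (a \<odot>\<^bsub>B\<^esub> b) = a \<odot>\<^bsub>B\<^esub> \<phi> b" if "a \<in> carrier R" "b \<in> carrier B" for a b
    using \<phi> that by (auto simp: mod_hom_def)
  have "frag_extend ?f c \<in> tensor_relators R B M \<union> frag_of ` (carrier B \<times> N)"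
    if "c \<in> tensor_relators R B M \<union> frag_of ` (carrier B \<times> N)" for c
    using that
  proof
    assume "c \<in> tensor_relators R B M"
    then have "frag_extend ?f c \<in> tensor_relators R B M"
    proof (cases rule: tensor_relators_cases)
      case (add_left b b' m)
      then show ?thesis
        using tensor_relators_intros(1)[of "\<phi> b" B "\<phi> b'" m M R]
        by (simp add: frag_extend_diff add cl)
    next
      case (add_right b m m')
      then show ?thesis
        using tensor_relators_intros(2)[of "\<phi> b" B m M m' R]
        by (simp add: frag_extend_diff cl)
    next
      case (balance a b m)
      then show ?thesis
        using tensor_relators_intros(3)[of a R "\<phi> b" B m M]
        by (simp add: frag_extend_diff smult cl)
    qed
    then show ?thesis ..
  next
    assume "c \<in> frag_of ` (carrier B \<times> N)"
    then show ?thesis using cl by auto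
  qed
  then have "frag_extend ?f (frag_of (b, u)) \<in> image_lift R B M N"
    using x unfolding image_lift_def by (meson frag_extend_frag_span frag_span_incl)
  then show ?thesis by simp
qed

text \<open>
  The biadditivity relators give closure under sums. Since \<open>R\<close> is commutative, multiplication by a scalar
  is itself an endomorphism of \<open>B\<close>, so closure under scalars is a case of the previous lemma.
\<close>

lemma submodule_of_image_lift:
  assumes B: "module R B" and u: "u \<in> carrier M"
  shows "submodule {b \<in> carrier B. frag_of (b, u) \<in> image_lift R B M N} R B" (is "submodule ?H R B")
proof -
  interpret module R B by fact
  have rel: "frag_of (b \<oplus>\<^bsub>B\<^esub> b', u) - frag_of (b, u) - frag_of (b', u) \<in> image_lift R B M N"
    if "b \<in> carrier B" "b' \<in> carrier B" for b b'
    unfolding image_lift_def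
    using that u by (simp add: frag_span_incl tensor_relators_intros(1))
  have smult: "a \<odot>\<^bsub>B\<^esub> b \<in> ?H" if "a \<in> carrier R" "b \<in> ?H" for a b
  proof -
    have "(\<lambda>b. a \<odot>\<^bsub>B\<^esub> b) \<in> mod_hom R B B"
      unfolding mod_hom_def
    proof (intro CollectI conjI homI ballI)
      fix a' x assume "a' \<in> carrier R" "x \<in> carrier B"
      then show "a \<odot>\<^bsub>B\<^esub> (a' \<odot>\<^bsub>B\<^esub> x) = a' \<odot>\<^bsub>B\<^esub> (a \<odot>\<^bsub>B\<^esub> x)"
        using that(1) smult_assoc1[of a a' x] smult_assoc1[of a' a x] R.m_comm[of a a'] by simp
    qed (use that(1) in \<open>simp_all add: smult_r_distr\<close>)
    from image_lift_endomorphism[OF this, of b u M N] show ?thesis using that by simp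
  qed
  have neg: "\<ominus>\<^bsub>B\<^esub> b \<in> ?H" if "b \<in> ?H" for b
    using smult[of "\<ominus>\<^bsub>R\<^esub> \<one>\<^bsub>R\<^esub>" b] that by (simp add: smult_l_minus)
  show ?thesis
  proof (rule submoduleI)
    \<comment> \<open>The relator for \<open>0 + 0\<close> is minus the generator \<open>(0, u)\<close>.\<close>
    have "- frag_of (\<zero>\<^bsub>B\<^esub>, u) \<in> image_lift R B M N"
      using rel[of "\<zero>\<^bsub>B\<^esub>" "\<zero>\<^bsub>B\<^esub>"] by simp
    from frag_span_minus[OF this[unfolded image_lift_def]] show "\<zero>\<^bsub>B\<^esub> \<in> ?H"
      by (simp add: image_lift_def)
    show "b \<oplus>\<^bsub>B\<^esub> b' \<in> ?H" if "b \<in> ?H" "b' \<in> ?H" for b b'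
    proof -
      have "frag_of (b \<oplus>\<^bsub>B\<^esub> b', u) =
          (frag_of (b \<oplus>\<^bsub>B\<^esub> b', u) - frag_of (b, u) - frag_of (b', u)) + frag_of (b, u) + frag_of (b', u)"
        by simp
      also have "\<dots> \<in> image_lift R B M N"
        using that rel[of b b'] unfolding image_lift_def by (intro frag_span_add) simp_all
      finally show ?thesis using that by simp
    qed
  qed (use smult neg in auto)
qed

lemma image_lift_from_generators:
  assumes B: "module R B" and u: "u \<in> carrier M"
    and S: "\<forall>H. submodule H R B \<and> (\<forall>\<phi>\<in>mod_hom R B B. \<phi> ` H \<subseteq> H) \<and> S \<subseteq> H \<longrightarrow> carrier B \<subseteq> H"
    and gen: "S \<subseteq> carrier B" "\<forall>s\<in>S. frag_of (s, u) \<in> image_lift R B M N"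
    and b: "b \<in> carrier B"
  shows "frag_of (b, u) \<in> image_lift R B M N"
proof -
  let ?H = "{b \<in> carrier B. frag_of (b, u) \<in> image_lift R B M N}"
  have "\<phi> ` ?H \<subseteq> ?H" if "\<phi> \<in> mod_hom R B B" for \<phi>
  proof (intro image_subsetI CollectI conjI)
    fix c assume c: "c \<in> ?H"
    show "\<phi> c \<in> carrier B" using that c by (auto simp: mod_hom_def hom_def)
    show "frag_of (\<phi> c, u) \<in> image_lift R B M N"
      using image_lift_endomorphism[OF that, of c u M N] c by simp
  qed
  moreover have "S \<subseteq> ?H" using gen by blast
  ultimately have "carrier B \<subseteq> ?H"
    using S[rule_format, of ?H] submodule_of_image_lift[of R B u M N, OF B u] by blast
  then show ?thesis using b by blast
qed


section \<open>Submodules generated by finitely many elements over a submodule\<close>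

lemma submodule_span_submodule:
  assumes M: "module R M" and S: "S \<subseteq> carrier M"
  shows "submodule (submodule_span R M S) R M"
proof -
  interpret module R M by fact
  have "submodule_span R M S \<subseteq> carrier M"
    using S carrier_is_submodule by (auto simp: submodule_span_def)
  moreover have "\<zero>\<^bsub>M\<^esub> \<in> H" if "submodule H R M" for H
    using subgroup.one_closed[OF submodule.axioms(1)[OF that]] by simp
  ultimately show ?thesis
    by (intro submoduleI) (auto simp: submodule_span_def submoduleE)
qed

lemma submodule_span_superset: "S \<subseteq> submodule_span R M S"
  by (auto simp: submodule_span_def)

lemma submodule_restrict:
  assumes "module R M" "submodule L R M" "submodule N R M" "N \<subseteq> L"
  shows "submodule N R (M\<lparr>carrier := L\<rparr>)"
  by (rule module.module_incl_imp_submodule[OF submodule.submodule_is_module[OF assms(2,1)]])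
    (use assms(4) submodule.submodule_is_module[OF assms(3,1)] in simp_all)

lemma submodule_trans:
  assumes "module R M" "submodule L R M" "submodule N R (M\<lparr>carrier := L\<rparr>)"
  shows "submodule N R M"
proof -
  have L: "module R (M\<lparr>carrier := L\<rparr>)" by (rule submodule.submodule_is_module[OF assms(2,1)])
  show ?thesis
    using module.submoduleE(1)[OF L assms(3)] module.submoduleE(1)[OF assms(1,2)]
      submodule.submodule_is_module[OF assms(3) L]
    by (intro module.module_incl_imp_submodule[OF assms(1)]) auto
qed

lemma submodule_span_restrict:
  assumes "module R M" "S \<subseteq> carrier M"
  shows "submodule_span R (M\<lparr>carrier := submodule_span R M S\<rparr>) S = submodule_span R M S"
proof -
  let ?L = "submodule_span R M S"
  have L: "submodule ?L R M" by (rule submodule_span_submodule[OF assms])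
  have "submodule ?L R (M\<lparr>carrier := ?L\<rparr>)"
    by (rule submodule_restrict[OF assms(1) L L]) simp
  then have "submodule_span R (M\<lparr>carrier := ?L\<rparr>) S \<subseteq> ?L"
    using submodule_span_superset[of S R M] unfolding submodule_span_def[of R "M\<lparr>carrier := ?L\<rparr>"]
    by blast
  moreover have "?L \<subseteq> submodule_span R (M\<lparr>carrier := ?L\<rparr>) S"
    unfolding submodule_span_def[of R "M\<lparr>carrier := ?L\<rparr>"]
    using submodule_trans[OF assms(1) L] unfolding submodule_span_def[of R M] by blast
  ultimately show ?thesis ..
qed

lemma abelian_subgroup_submodule:
  assumes "module R M" "submodule N R M"
  shows "abelian_subgroup N M"
proof -
  interpret module R M by fact
  show ?thesis
    by (rule abelian_subgroupI3[OF additive_subgroupI[OF submodule.axioms(1)[OF assms(2)]]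
      abelian_group_axioms])
qed

lemma quotient_module_carrier:
  "carrier (quotient_module M N) = (\<lambda>x. N +>\<^bsub>M\<^esub> x) ` carrier M"
  by (auto simp: quotient_module_def A_RCOSETS_def')

lemma quotient_module_add:
  assumes "module R M" "submodule N R M" "x \<in> carrier M" "y \<in> carrier M"
  shows "(N +>\<^bsub>M\<^esub> x) \<oplus>\<^bsub>quotient_module M N\<^esub> (N +>\<^bsub>M\<^esub> y) = N +>\<^bsub>M\<^esub> (x \<oplus>\<^bsub>M\<^esub> y)"
  using abelian_subgroup.a_rcos_sum[OF abelian_subgroup_submodule[OF assms(1,2)] assms(3,4)]
  by (simp add: quotient_module_def)

lemma quotient_module_zero:
  assumes "module R M" "submodule N R M" "x \<in> N"
  shows "\<zero>\<^bsub>quotient_module M N\<^esub> = N +>\<^bsub>M\<^esub> x"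
  using abelian_subgroup.a_rcos_const[OF abelian_subgroup_submodule[OF assms(1,2)] assms(3)]
  by (simp add: quotient_module_def)

text \<open>
  Representatives of one coset differ by elements of \<open>N\<close>, which scalars preserve; hence the cosets in the
  union that defines the scalar multiplication coincide.
\<close>

lemma quotient_module_smult:
  assumes M: "module R M" and N: "submodule N R M" and a: "a \<in> carrier R" and x: "x \<in> carrier M"
  shows "a \<odot>\<^bsub>quotient_module M N\<^esub> (N +>\<^bsub>M\<^esub> x) = N +>\<^bsub>M\<^esub> (a \<odot>\<^bsub>M\<^esub> x)"
proof -
  interpret module R M by fact
  interpret N: abelian_subgroup N M by (rule abelian_subgroup_submodule[OF M N])
  have "N +>\<^bsub>M\<^esub> (a \<odot>\<^bsub>M\<^esub> y) = N +>\<^bsub>M\<^esub> (a \<odot>\<^bsub>M\<^esub> x)" if y: "y \<in> N +>\<^bsub>M\<^esub> x" for y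
  proof -
    obtain n where n: "n \<in> N" "y = n \<oplus>\<^bsub>M\<^esub> x"
      using y by (auto simp: a_r_coset_def')
    then have "a \<odot>\<^bsub>M\<^esub> y = a \<odot>\<^bsub>M\<^esub> n \<oplus>\<^bsub>M\<^esub> a \<odot>\<^bsub>M\<^esub> x"
      using a x by (simp add: smult_r_distr)
    moreover have "a \<odot>\<^bsub>M\<^esub> n \<in> N" using submoduleE(4)[OF N] a n(1) by blast
    ultimately have "a \<odot>\<^bsub>M\<^esub> y \<in> N +>\<^bsub>M\<^esub> (a \<odot>\<^bsub>M\<^esub> x)"
      by (auto simp: a_r_coset_def')
    then show ?thesis
      using N.a_repr_independence'[of "a \<odot>\<^bsub>M\<^esub> y" "a \<odot>\<^bsub>M\<^esub> x"] a x by simp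
  qed
  moreover have "x \<in> N +>\<^bsub>M\<^esub> x" using x by (rule N.a_rcos_self)
  ultimately have "(\<Union>y\<in>N +>\<^bsub>M\<^esub> x. N +>\<^bsub>M\<^esub> (a \<odot>\<^bsub>M\<^esub> y)) = N +>\<^bsub>M\<^esub> (a \<odot>\<^bsub>M\<^esub> x)"
    by (intro SUP_eq_const) blast+
  then show ?thesis by (simp add: quotient_module_def)
qed

lemma quotient_module_additive_group:
  assumes M: "module R M" and N: "submodule N R M"
  shows "group (add_monoid (quotient_module M N))"
proof -
  interpret module R M by fact
  have zero: "\<zero>\<^bsub>quotient_module M N\<^esub> = N +>\<^bsub>M\<^esub> \<zero>\<^bsub>M\<^esub>"
    using quotient_module_zero[OF M N] subgroup.one_closed[OF submodule.axioms(1)[OF N]] by simp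
  note add = quotient_module_add[OF M N]
  have closed: "N +>\<^bsub>M\<^esub> x \<in> carrier (quotient_module M N)" if "x \<in> carrier M" for x
    using that by (simp add: quotient_module_carrier)
  show ?thesis
  proof (rule groupI, unfold monoid.simps partial_object.simps)
    fix C D
    assume "C \<in> carrier (quotient_module M N)" "D \<in> carrier (quotient_module M N)"
    then obtain x y where xy: "x \<in> carrier M" "C = N +>\<^bsub>M\<^esub> x" "y \<in> carrier M" "D = N +>\<^bsub>M\<^esub> y"
      unfolding quotient_module_carrier by blast
    show "C \<oplus>\<^bsub>quotient_module M N\<^esub> D \<in> carrier (quotient_module M N)"
      by (simp add: xy add closed)
    fix E
    assume "E \<in> carrier (quotient_module M N)"
    then obtain z where z: "z \<in> carrier M" "E = N +>\<^bsub>M\<^esub> z"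
      unfolding quotient_module_carrier by blast
    show "C \<oplus>\<^bsub>quotient_module M N\<^esub> D \<oplus>\<^bsub>quotient_module M N\<^esub> E =
        C \<oplus>\<^bsub>quotient_module M N\<^esub> (D \<oplus>\<^bsub>quotient_module M N\<^esub> E)"
      by (simp add: xy z add M.a_assoc)
  next
    show "\<zero>\<^bsub>quotient_module M N\<^esub> \<in> carrier (quotient_module M N)"
      unfolding zero by (rule closed) simp
  next
    fix C
    assume "C \<in> carrier (quotient_module M N)"
    then obtain x where x: "x \<in> carrier M" "C = N +>\<^bsub>M\<^esub> x"
      unfolding quotient_module_carrier by blast
    have "(N +>\<^bsub>M\<^esub> \<zero>\<^bsub>M\<^esub>) \<oplus>\<^bsub>quotient_module M N\<^esub> (N +>\<^bsub>M\<^esub> x) = N +>\<^bsub>M\<^esub> x"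
      using add[of "\<zero>\<^bsub>M\<^esub>" x] x(1) by simp
    then show "\<zero>\<^bsub>quotient_module M N\<^esub> \<oplus>\<^bsub>quotient_module M N\<^esub> C = C"
      unfolding zero x(2) .
    have "(N +>\<^bsub>M\<^esub> (\<ominus>\<^bsub>M\<^esub> x)) \<oplus>\<^bsub>quotient_module M N\<^esub> C = \<zero>\<^bsub>quotient_module M N\<^esub>"
      unfolding zero x(2) using add[of "\<ominus>\<^bsub>M\<^esub> x" x] x(1) by (simp add: M.l_neg)
    moreover have "N +>\<^bsub>M\<^esub> (\<ominus>\<^bsub>M\<^esub> x) \<in> carrier (quotient_module M N)"
      using x(1) by (intro closed) simp
    ultimately show "\<exists>D\<in>carrier (quotient_module M N).
        D \<oplus>\<^bsub>quotient_module M N\<^esub> C = \<zero>\<^bsub>quotient_module M N\<^esub>" by blast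
  qed
qed

lemma quotient_module_carrier_submodule:
  assumes M: "module R M" and N: "submodule N R M"
  shows "submodule (carrier (quotient_module M N)) R (quotient_module M N)"
proof (rule submodule.intro)
  show "subgroup (carrier (quotient_module M N)) (add_monoid (quotient_module M N))"
    using group.subgroup_self[OF quotient_module_additive_group[OF assms]] by simp
  show "submodule_axioms (carrier (quotient_module M N)) R (quotient_module M N)"
  proof (rule submodule_axioms.intro)
    fix a C
    assume a: "a \<in> carrier R" and "C \<in> carrier (quotient_module M N)"
    then obtain x where "x \<in> carrier M" "C = N +>\<^bsub>M\<^esub> x"
      unfolding quotient_module_carrier by blast
    then show "a \<odot>\<^bsub>quotient_module M N\<^esub> C \<in> carrier (quotient_module M N)"
      using quotient_module_smult[OF M N a] module.smult_closed[OF M a]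
      by (simp add: quotient_module_carrier)
  qed
qed

text \<open>
  The cosets of \<open>F\<close> generate \<open>M/N\<close>: the preimage in \<open>M\<close> of a submodule of \<open>M/N\<close> that contains them is a
  submodule containing \<open>N\<close> and \<open>F\<close>, hence all of \<open>M\<close>.
\<close>

lemma finitely_generated_quotient_module:
  assumes M: "module R M" and N: "submodule N R M"
    and F: "finite F" "F \<subseteq> carrier M" and span: "submodule_span R M (N \<union> F) = carrier M"
  shows "finitely_generated R (quotient_module M N)"
proof -
  interpret module R M by fact
  let ?Q = "quotient_module M N"
  have "carrier ?Q \<subseteq> H"
    if H: "submodule H R ?Q" and FH: "(\<lambda>x. N +>\<^bsub>M\<^esub> x) ` F \<subseteq> H" for H
  proof -
    note H_group = submodule.axioms(1)[OF H]
    let ?P = "{x \<in> carrier M. N +>\<^bsub>M\<^esub> x \<in> H}"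
    have smult_P: "a \<odot>\<^bsub>M\<^esub> x \<in> ?P" if "a \<in> carrier R" "x \<in> ?P" for a x
      using that submodule.smult_closed[OF H, of a "N +>\<^bsub>M\<^esub> x"] quotient_module_smult[OF M N] by simp
    have zero_H: "N +>\<^bsub>M\<^esub> x \<in> H" if "x \<in> N" for x
      using subgroup.one_closed[OF H_group] quotient_module_zero[OF M N that] by simp
    have N_P: "N \<subseteq> ?P"
      using zero_H submoduleE(1)[OF N] by blast
    have zero_P: "\<zero>\<^bsub>M\<^esub> \<in> ?P"
      using N_P subgroup.one_closed[OF submodule.axioms(1)[OF N]] by auto
    have P: "submodule ?P R M"
    proof (rule submoduleI)
      show "\<ominus>\<^bsub>M\<^esub> x \<in> ?P" if "x \<in> ?P" for x
        using smult_P[of "\<ominus>\<^bsub>R\<^esub> \<one>\<^bsub>R\<^esub>" x] that by (simp add: smult_l_minus)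
      show "x \<oplus>\<^bsub>M\<^esub> y \<in> ?P" if "x \<in> ?P" "y \<in> ?P" for x y
        using that subgroup.m_closed[OF H_group, of "N +>\<^bsub>M\<^esub> x" "N +>\<^bsub>M\<^esub> y"]
          quotient_module_add[OF M N] by simp
    qed (use smult_P zero_P in auto)
    have "N \<union> F \<subseteq> ?P"
      using N_P FH F(2) by blast
    with P have "carrier M \<subseteq> ?P"
      unfolding span[symmetric] submodule_span_def by blast
    then show ?thesis by (auto simp: quotient_module_carrier)
  qed
  moreover have "(\<lambda>x. N +>\<^bsub>M\<^esub> x) ` F \<subseteq> carrier ?Q"
    using F(2) by (auto simp: quotient_module_carrier)
  ultimately have "submodule_span R ?Q ((\<lambda>x. N +>\<^bsub>M\<^esub> x) ` F) = carrier ?Q"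
    using quotient_module_carrier_submodule[OF M N] unfolding submodule_span_def by blast
  with \<open>(\<lambda>x. N +>\<^bsub>M\<^esub> x) ` F \<subseteq> carrier ?Q\<close> show ?thesis
    unfolding finitely_generated_def using F(1) by blast
qed


section \<open>The finitistic test ideal and the test ideal\<close>

text \<open>
  The submodule \<open>L\<close> is generated by \<open>N\<close>, the element \<open>u\<close> and the finitely many elements that witness
  the closure condition at a finite set of generators of \<open>B\<close> over its endomorphism ring. Keeping all of
  \<open>N\<close> in \<open>L\<close> lets the tensor product \<open>B \<otimes> N\<close> stay the same when \<open>M\<close> is replaced by \<open>L\<close>.
\<close>

lemma module_closure_finitistic:
  assumes B: "module R B" "End_finitely_generated R B"
    and M: "module R M" and N: "submodule N R M" and u: "u \<in> module_closure R B M N"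
  shows "\<exists>L. submodule L R M \<and> N \<subseteq> L \<and>
    finitely_generated R (quotient_module (M\<lparr>carrier := L\<rparr>) N) \<and>
    u \<in> module_closure R B (M\<lparr>carrier := L\<rparr>) N"
proof -
  obtain S where S: "finite S" "S \<subseteq> carrier B"
    "\<forall>H. submodule H R B \<and> (\<forall>\<phi>\<in>mod_hom R B B. \<phi> ` H \<subseteq> H) \<and> S \<subseteq> H \<longrightarrow> carrier B \<subseteq> H"
    using B(2) unfolding End_finitely_generated_def by blast
  have uM: "u \<in> carrier M" and lift: "\<And>b. b \<in> carrier B \<Longrightarrow> frag_of (b, u) \<in> image_lift R B M N"
    using u by (auto simp: module_closure_eq[OF B(1) M N])
  have "\<forall>s\<in>S. \<exists>F. finite F \<and> F \<subseteq> carrier M \<and>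
      (\<forall>L. F \<subseteq> L \<longrightarrow> frag_of (s, u) \<in> image_lift R B (M\<lparr>carrier := L\<rparr>) N)"
  proof
    fix s assume "s \<in> S"
    then have "frag_of (s, u) \<in> image_lift R B M N" using S(2) lift by blast
    then show "\<exists>F. finite F \<and> F \<subseteq> carrier M \<and>
        (\<forall>L. F \<subseteq> L \<longrightarrow> frag_of (s, u) \<in> image_lift R B (M\<lparr>carrier := L\<rparr>) N)"
      by (rule image_lift_local)
  qed
  from bchoice[OF this] obtain F where F: "\<forall>s\<in>S. finite (F s) \<and> F s \<subseteq> carrier M \<and>
      (\<forall>L. F s \<subseteq> L \<longrightarrow> frag_of (s, u) \<in> image_lift R B (M\<lparr>carrier := L\<rparr>) N)" ..
  define G where "G = insert u (\<Union>s\<in>S. F s)"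
  define L where "L = submodule_span R M (N \<union> G)"
  have G: "finite G" "G \<subseteq> carrier M"
    using F S(1) uM by (auto simp: G_def)
  have NG: "N \<union> G \<subseteq> carrier M" using G(2) module.submoduleE(1)[OF M N] by blast
  have L: "submodule L R M" unfolding L_def by (rule submodule_span_submodule[OF M NG])
  have NGL: "N \<union> G \<subseteq> L" unfolding L_def by (rule submodule_span_superset)
  have L': "module R (M\<lparr>carrier := L\<rparr>)" by (rule submodule.submodule_is_module[OF L M])
  have N': "submodule N R (M\<lparr>carrier := L\<rparr>)"
    using submodule_restrict[OF M L N] NGL by blast
  have span: "submodule_span R (M\<lparr>carrier := L\<rparr>) (N \<union> G) = carrier (M\<lparr>carrier := L\<rparr>)"
    using submodule_span_restrict[OF M NG] by (simp add: L_def)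
  have fg: "finitely_generated R (quotient_module (M\<lparr>carrier := L\<rparr>) N)"
    using finitely_generated_quotient_module[OF L' N' G(1) _ span] NGL by simp
  have uL: "u \<in> L" using NGL by (auto simp: G_def)
  have "frag_of (s, u) \<in> image_lift R B (M\<lparr>carrier := L\<rparr>) N" if "s \<in> S" for s
  proof -
    have "F s \<subseteq> L" using that NGL by (auto simp: G_def)
    then show ?thesis using F that by blast
  qed
  then have "frag_of (b, u) \<in> image_lift R B (M\<lparr>carrier := L\<rparr>) N" if "b \<in> carrier B" for b
    using image_lift_from_generators[OF B(1) _ S(3,2) _ that, of u "M\<lparr>carrier := L\<rparr>" N] uL by simp
  then have "u \<in> module_closure R B (M\<lparr>carrier := L\<rparr>) N"
    using uL by (simp add: module_closure_eq[OF B(1) L' N'])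
  with L NGL fg show ?thesis by blast
qed

lemma test_ideal_trivial_iff:
  assumes B: "module R B" "End_finitely_generated R B"
  shows "fg_test_ideal TYPE('m) R B = carrier R \<longleftrightarrow> test_ideal TYPE('m) R B = carrier R"
proof
  assume "test_ideal TYPE('m) R B = carrier R"
  then show "fg_test_ideal TYPE('m) R B = carrier R"
    unfolding test_ideal_def fg_test_ideal_def by blast
next
  assume fg: "fg_test_ideal TYPE('m) R B = carrier R"
  interpret B: module R B by fact
  have "carrier R \<subseteq> colon_ideal R M N (module_closure R B M N)"
    if M: "module R M" and N: "submodule N R M" for M :: "('a, 'm) module" and N
  proof
    fix a assume a: "a \<in> carrier R"
    have "u \<in> N" if u: "u \<in> module_closure R B M N" for u
    proof -
      obtain L where L: "submodule L R M" "N \<subseteq> L"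
        "finitely_generated R (quotient_module (M\<lparr>carrier := L\<rparr>) N)"
        "u \<in> module_closure R B (M\<lparr>carrier := L\<rparr>) N"
        using module_closure_finitistic[OF B M N u] by blast
      have "\<one>\<^bsub>R\<^esub> \<in> fg_test_ideal TYPE('m) R B" using fg by simp
      then have "\<one>\<^bsub>R\<^esub> \<in> colon_ideal R (M\<lparr>carrier := L\<rparr>) N (module_closure R B (M\<lparr>carrier := L\<rparr>) N)"
        using submodule.submodule_is_module[OF L(1) M] submodule_restrict[OF M L(1) N L(2)] L(3)
        unfolding fg_test_ideal_def by blast
      then have "\<one>\<^bsub>R\<^esub> \<odot>\<^bsub>M\<^esub> u \<in> N" using L(4) by (auto simp: colon_ideal_def)
      moreover have "u \<in> carrier M" using u by (simp add: module_closure_def)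
      ultimately show ?thesis using module.smult_one[OF M] by simp
    qed
    then show "a \<in> colon_ideal R M N (module_closure R B M N)"
      using a module.submoduleE(4)[OF M N] by (auto simp: colon_ideal_def)
  qed
  then show "test_ideal TYPE('m) R B = carrier R"
    unfolding test_ideal_def by blast
qed

theorem proposition3p10:
  fixes R :: "('a, 'r) ring_scheme" and B :: "('a, 'b) module"
  assumes "gorenstein_local_ring TYPE('i) R"
    and "associative_algebra R B \<or> (module R B \<and> finitely_generated R B)"
  shows "fg_test_ideal TYPE('m) R B = carrier R \<longleftrightarrow> test_ideal TYPE('m) R B = carrier R"
proof (rule test_ideal_trivial_iff)
  show "module R B"
    using assms(2) associative_algebra.axioms(1) by blast
  show "End_finitely_generated R B"
    using assms(2) associative_algebra_imp_End_finitely_generated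
      finitely_generated_imp_End_finitely_generated by blast
qed

end
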